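(* Let $K$ be a field and $(h_n)_{n>0}$ a sequence in $K$ satisfying $$h_{m+n}h_{m-n}h_r^2=h_{m+r}h_{m-r}h_n^2-h_{n+r}h_{n-r}h_m^2$$ for all integers $m>n>r>0$. Then (restricting to positive indices) $h$ falls in one of the following cases: (i) there exist an odd $r\in\mathbb{Z}^+$ and $A,B,C,D\in K$ such that $h=A\cdot\operatorname{EDS}(B,C,D)^{[1/r]}$; (ii) there exist $r,s\in\mathbb{Z}^+$ of opposite parity with $r<s\ne2r$ and $A,B,D\in K$ such that $h=A\cdot\operatorname{ES}_{r,s}(B,D)$; (iii) there exist an even $r\in\mathbb{Z}^+$ and $A,C\in K$ such that $h=A\cdot\operatorname{EDS}(0,C,0)^{[1/r]}$. Moreover, all sequences of the forms (i), (ii), (iii) are elliptic, i.e. satisfy $h_{a+b}h_{a-b}h_{c+d}h_{c-d}=h_{a+c}h_{a-c}h_{b+d}h_{b-d}-h_{b+c}h_{b-c}h_{a+d}h_{a-d}$ for all integers $a>b>c>d\ge0$.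
   Context: Standard EDS: given $B,C,D\in K$, define $(\tilde h_n)_{n\in\mathbb{Z}}$ by $\tilde h_0=0$, $\tilde h_1=\tilde h_2=1$, $\tilde h_3=C$, $\tilde h_4=D$, and $\tilde h_{2n+1}=B^4\tilde h_{n+2}\tilde h_n^3-\tilde h_{n-1}\tilde h_{n+1}^3$ for even $n\ge2$; $\tilde h_{2n+1}=\tilde h_{n+2}\tilde h_n^3-B^4\tilde h_{n-1}\tilde h_{n+1}^3$ for odd $n\ge3$; $\tilde h_{2n}=\tilde h_n(\tilde h_{n+2}\tilde h_{n-1}^2-\tilde h_{n+1}^2\tilde h_{n-2})$ for $n\ge3$; $\tilde h_n=-\tilde h_{-n}$ for $n<0$. $\operatorname{EDS}(B,C,D)$ is $(e_n)$ with $e_n=\tilde h_n$ for $n$ odd and $e_n=B\tilde h_n$ for $n$ even. Dilation: for a sequence $(g_n)_{n>0}$ and $\ell\in\mathbb{Z}^+$, $g^{[1/\ell]}$ is the sequence with $g^{[1/\ell]}_{n\ell}=g_n$ and $g^{[1/\ell]}_n=0$ if $\ell\nmid n$. Scalar multiples $A\cdot g$ are taken termwise. $A\cdot\operatorname{ES}_{r,s}(B,D)$ (for $r<s$ positive of opposite parity) is the sequence with $h_m=-AB^{k(k+1)/2}D^{k(k-1)/2}$ if $m=k(r+s)-r$, $h_m=AB^{k(k-1)/2}D^{k(k+1)/2}$ if $m=k(r+s)+r$ ($k\in\mathbb{Z}$), and $h_m=0$ if $m\not\equiv\pm r\pmod{r+s}$. *)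

theory Defs
  imports Main
begin

text \<open>
  Sequences are functions on \<^typ>\<open>int\<close>. For a sequence \<open>(h n)\<close> with \<open>n > 0\<close> only the values
  at positive indices are meaningful, and only those occur in the identities below.
\<close>

function eds_tilde :: "'a::field \<Rightarrow> 'a \<Rightarrow> 'a \<Rightarrow> int \<Rightarrow> 'a" where
  "eds_tilde B C D m =
    (if m < 0 then - eds_tilde B C D (- m)
     else if m = 0 then 0
     else if m = 1 then 1
     else if m = 2 then 1
     else if m = 3 then C
     else if m = 4 then D
     else if even m then
       eds_tilde B C D (m div 2) *
         (eds_tilde B C D (m div 2 + 2) * eds_tilde B C D (m div 2 - 1) ^ 2
          - eds_tilde B C D (m div 2 + 1) ^ 2 * eds_tilde B C D (m div 2 - 2))
     else if even (m div 2) then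
       B ^ 4 * eds_tilde B C D (m div 2 + 2) * eds_tilde B C D (m div 2) ^ 3
         - eds_tilde B C D (m div 2 - 1) * eds_tilde B C D (m div 2 + 1) ^ 3
     else
       eds_tilde B C D (m div 2 + 2) * eds_tilde B C D (m div 2) ^ 3
         - B ^ 4 * eds_tilde B C D (m div 2 - 1) * eds_tilde B C D (m div 2 + 1) ^ 3)"
  by pat_completeness auto
termination
  by (relation "measure (\<lambda>(B, C, D, m). nat (2 * \<bar>m\<bar>) + (if m < 0 then 1 else 0))") auto

declare eds_tilde.simps [simp del]

lemma eds_tilde_initial:
  "eds_tilde B C D 0 = 0" "eds_tilde B C D 1 = 1" "eds_tilde B C D 2 = 1"
  "eds_tilde B C D 3 = C" "eds_tilde B C D 4 = D"
  by (simp_all add: eds_tilde.simps)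

lemma eds_tilde_odd_even:
  assumes "even n" "n \<ge> 2"
  shows "eds_tilde B C D (2 * n + 1) =
    B ^ 4 * eds_tilde B C D (n + 2) * eds_tilde B C D n ^ 3
    - eds_tilde B C D (n - 1) * eds_tilde B C D (n + 1) ^ 3"
  using assms by (subst eds_tilde.simps) simp

lemma eds_tilde_odd_odd:
  assumes "odd n" "n \<ge> 3"
  shows "eds_tilde B C D (2 * n + 1) =
    eds_tilde B C D (n + 2) * eds_tilde B C D n ^ 3
    - B ^ 4 * eds_tilde B C D (n - 1) * eds_tilde B C D (n + 1) ^ 3"
  using assms by (subst eds_tilde.simps) simp

lemma eds_tilde_even:
  assumes "n \<ge> 3"
  shows "eds_tilde B C D (2 * n) = eds_tilde B C D n *
    (eds_tilde B C D (n + 2) * eds_tilde B C D (n - 1) ^ 2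
     - eds_tilde B C D (n + 1) ^ 2 * eds_tilde B C D (n - 2))"
  using assms by (subst eds_tilde.simps) simp

lemma eds_tilde_neg: "n < 0 \<Longrightarrow> eds_tilde B C D n = - eds_tilde B C D (- n)"
  by (subst eds_tilde.simps) simp

definition EDS :: "'a::field \<Rightarrow> 'a \<Rightarrow> 'a \<Rightarrow> int \<Rightarrow> 'a" where
  "EDS B C D n = (if odd n then eds_tilde B C D n else B * eds_tilde B C D n)"

definition dilate :: "int \<Rightarrow> (int \<Rightarrow> 'a::field) \<Rightarrow> int \<Rightarrow> 'a" where
  "dilate l g n = (if l dvd n then g (n div l) else 0)"

text \<open>
  The sequence \<open>ES\<^sub>r\<^sub>,\<^sub>s(B,D)\<close> without the scalar factor \<open>A\<close>. For \<open>0 < r < s\<close> the integers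
  \<open>k\<close> below are the unique ones with \<open>m = k(r+s) - r\<close>, respectively \<open>m = k(r+s) + r\<close>, and the
  two cases exclude each other because \<open>2r < r + s\<close>. The exponents are nonnegative for every
  integer \<open>k\<close>, and \<open>0 ^ 0 = 1\<close>.
\<close>

definition ES :: "int \<Rightarrow> int \<Rightarrow> 'a::field \<Rightarrow> 'a \<Rightarrow> int \<Rightarrow> 'a" where
  "ES r s B D m =
    (if (r + s) dvd (m + r) then
       (let k = (m + r) div (r + s)
        in - (B ^ nat (k * (k + 1) div 2) * D ^ nat (k * (k - 1) div 2)))
     else if (r + s) dvd (m - r) then
       (let k = (m - r) div (r + s)
        in B ^ nat (k * (k - 1) div 2) * D ^ nat (k * (k + 1) div 2))
     else 0)"

lemma ES_minus:
  assumes "0 < r" "r < s"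
  shows "ES r s B D (k * (r + s) - r) =
    - (B ^ nat (k * (k + 1) div 2) * D ^ nat (k * (k - 1) div 2))"
  using assms by (simp add: ES_def)

lemma ES_plus:
  assumes "0 < r" "r < s"
  shows "ES r s B D (k * (r + s) + r) =
    B ^ nat (k * (k - 1) div 2) * D ^ nat (k * (k + 1) div 2)"
proof -
  have "\<not> (r + s) dvd (2 * r)"
    using assms zdvd_not_zless by auto
  moreover have "k * (r + s) + r + r = 2 * r + k * (r + s)" by simp
  ultimately have "\<not> (r + s) dvd (k * (r + s) + r + r)"
    by (metis dvd_add_left_iff dvd_triv_right)
  then show ?thesis using assms by (simp add: ES_def)
qed

definition elliptic :: "(int \<Rightarrow> 'a::field) \<Rightarrow> bool" where
  "elliptic h \<longleftrightarrow> (\<forall>a b c d. a > b \<and> b > c \<and> c > d \<and> d \<ge> 0 \<longrightarrow>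
     h (a + b) * h (a - b) * h (c + d) * h (c - d) =
       h (a + c) * h (a - c) * h (b + d) * h (b - d)
       - h (b + c) * h (b - c) * h (a + d) * h (a - d))"

end

(* Write F(a,b) = h(a+b) h(a-b).  The elliptic relation says that F satisfies the Pluecker
   relations, so h is elliptic as soon as F(a,b) = P(a) Q(b) - Q(a) P(b) for some P, Q.

   For EDS(B,C,D) the recursions are instances of this with base pair (1,0), or with base pair
   (3/2,1/2) if half-integers are admitted.  The relation for (a,b,c,d) has the same terms as the
   one for (s-d,s-c,s-b,s-a), where s = (a+b+c+d)/2, and both involve the same largest index a+b;
   this turns a relation with base (1,0) or (3/2,1/2) into one whose first two entries differ
   by 1.  All but one value of F occurring there are known by induction on a+b, and the remaining
   one by the recursions.  Working with the sequence without the factors B keeps the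
   argument free of divisions, so that B = 0 needs no special treatment.

   For the converse let r be the least index with h(r) nonzero and s, if it exists, the least such
   index of parity opposite to r.  The relations for (h(r), h(s)) determine h from its values at
   n <= 3r (n of the parity of r) and n <= s+2r (n of the other parity), and almost all of
   these vanish.  The case s = 2r gives an EDS, s not equal to 2r forces h(3r) = 0 and gives
   ES, and if s does not exist h is a dilation of EDS(0,C,0). *)

theory Submission
  imports Defs
begin

section \<open>Ellipticity from a product formula\<close>

text \<open>The products are 2x2 minors of the columns \<open>(P x, Q x)\<close>, so the claim is
  the three-term Pluecker identity. The formula is required only for 0 <= b < a, which covers all
  six pairs in the elliptic relation.\<close>

lemma ellipticI:
  assumes "\<And>a b. 0 \<le> b \<Longrightarrow> b < a \<Longrightarrow> h (a + b) * h (a - b) = P a * Q b - Q a * P b"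
  shows "elliptic h"
  unfolding elliptic_def
proof (intro allI impI)
  fix a b c d :: int
  assume o: "a > b \<and> b > c \<and> c > d \<and> d \<ge> 0"
  have e: "h (a + b) * h (a - b) = P a * Q b - Q a * P b"
    "h (a + c) * h (a - c) = P a * Q c - Q a * P c"
    "h (a + d) * h (a - d) = P a * Q d - Q a * P d"
    "h (b + c) * h (b - c) = P b * Q c - Q b * P c"
    "h (b + d) * h (b - d) = P b * Q d - Q b * P d"
    "h (c + d) * h (c - d) = P c * Q d - Q c * P d"
    using o by (intro assms; linarith)+
  show "h (a + b) * h (a - b) * h (c + d) * h (c - d) =
       h (a + c) * h (a - c) * h (b + d) * h (b - d)
       - h (b + c) * h (b - c) * h (a + d) * h (a - d)"
    using e by algebra
qed

section \<open>Elliptic divisibility sequences\<close>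

text \<open>The power of B left in EDS(a+1) EDS(a-1) EDS(b)^2 after cancelling the factors B of
  EDS(a+b) EDS(a-b). For a, b of equal parity both products carry B^2; for a odd and b even the
  first carries B^4 and the second none.\<close>

definition parity_weight :: "'a::field \<Rightarrow> int \<Rightarrow> int \<Rightarrow> 'a" where
  "parity_weight B a b = (if odd a \<and> even b then B ^ 4 else 1)"

text \<open>
  The second conjunct is the elliptic relation for \<open>(i + 1/2, j + 1/2, 3/2, 1/2)\<close>. In it each
  product \<open>g (a + b) * g (a - b)\<close> has exactly one even index, so the factors \<open>B\<close> of the sequence
  \<open>EDS\<close> cancel; in the first conjunct they survive as the weights.
\<close>

lemma eds_tilde_bilinear:
  fixes B C D :: "'a::field"
  defines "g \<equiv> eds_tilde B C D" and "w \<equiv> parity_weight B"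
  shows "(\<forall>a b. 0 \<le> b \<and> b < a \<and> nat (a + b) = N \<longrightarrow> g (a + b) * g (a - b) =
      w a b * (g (a + 1) * g (a - 1)) * (g b)^2 - w b a * (g a)^2 * (g (b + 1) * g (b - 1))) \<and>
    (\<forall>i j. 0 \<le> j \<and> j < i \<and> nat (i + j + 1) = N \<longrightarrow> g (i + j + 1) * g (i - j) =
      (g (i + 2) * g (i - 1)) * (g (j + 1) * g j) - (g (i + 1) * g i) * (g (j + 2) * g (j - 1)))"
\<comment> \<open>N is the largest index occurring. The two families need a joint induction, since
  the transformation can turn a relation with integer base into one with half-integer base and
  conversely.\<close>
proof (induction N rule: less_induct)
  case (less N)
  \<comment> \<open>The value at -1 enters when the second entry is 0: it makes the subtracted term
    equal to the left-hand side.\<close>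
  have g0 [simp]: "g 0 = 0" and g1 [simp]: "g 1 = 1" and g2 [simp]: "g 2 = 1" and
    gm1 [simp]: "g (-1) = -1"
    using eds_tilde_neg[of "-1" B C D] by (simp_all add: g_def eds_tilde_initial)
  have I: "g (a + b) * g (a - b) =
      w a b * (g (a + 1) * g (a - 1)) * (g b)^2 - w b a * (g a)^2 * (g (b + 1) * g (b - 1))"
    if "0 \<le> b" "b < a" "a + b < int N" for a b
    using less.IH[of "nat (a + b)"] that by auto
  have H: "g (i + j + 1) * g (i - j) =
      (g (i + 2) * g (i - 1)) * (g (j + 1) * g j) - (g (i + 1) * g i) * (g (j + 2) * g (j - 1))"
    if "0 \<le> j" "j < i" "i + j + 1 < int N" for i j
    using less.IH[of "nat (i + j + 1)"] that by auto
  \<comment> \<open>The odd recursions are the first relation for (n+1, n), as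
    \<open>g 1 = 1\<close>.\<close>
  have Iodd: "g (2 * n + 1) =
      w (n + 1) n * (g (n + 2) * g n) * (g n)^2 - w n (n + 1) * (g (n + 1))^2 * (g (n + 1) * g (n - 1))"
    if "n \<ge> 2" for n
  proof (cases "even n")
    case True
    then show ?thesis
      using eds_tilde_odd_even[of n B C D] that
      by (simp add: w_def parity_weight_def g_def power2_eq_square power3_eq_cube)
  next
    case False
    moreover from this that have "n \<ge> 3" by presburger
    ultimately show ?thesis
      using eds_tilde_odd_odd[of n B C D]
      by (simp add: w_def parity_weight_def g_def power2_eq_square power3_eq_cube)
  qed
  \<comment> \<open>The even recursion is the second relation for (n, n-1). As
    \<open>g 1 = g 2\<close>, it is also the first relation for (n+1, n-1).\<close>
  have Heven: "g (2 * n) = (g (n + 2) * g (n - 1)) * (g n * g (n - 1))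
      - (g (n + 1) * g n) * (g (n + 1) * g (n - 2))" if "n \<ge> 3" for n
    using eds_tilde_even[of n B C D] that
    by (simp add: g_def power2_eq_square algebra_simps)
  have A: "g (a + b) * g (a - b) =
      w a b * (g (a + 1) * g (a - 1)) * (g b)^2 - w b a * (g a)^2 * (g (b + 1) * g (b - 1))"
    if ab: "0 \<le> b" "b < a" "a + b = int N" for a b
  proof -
    \<comment> \<open>Entries b = 0, 1 are trivial and differences 1, 2 are the recursions.
      Otherwise n and k are the halves, rounded down, of a+b and a-b; \<open>b \<ge> 2\<close> keeps
      a+1 below N.\<close>
    consider "b = 0" | "b = 1" | "b \<ge> 2" "a = b + 1" | "b \<ge> 2" "a = b + 2"
      | n k where "a = n + k" "b = n - k" "k \<ge> 2" "b \<ge> 2"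
      | n k where "a = n + k + 1" "b = n - k" "k \<ge> 1" "b \<ge> 2"
    proof -
      assume c: "b = 0 \<Longrightarrow> thesis" "b = 1 \<Longrightarrow> thesis" "b \<ge> 2 \<Longrightarrow> a = b + 1 \<Longrightarrow> thesis"
        "b \<ge> 2 \<Longrightarrow> a = b + 2 \<Longrightarrow> thesis"
        "\<And>n k. a = n + k \<Longrightarrow> b = n - k \<Longrightarrow> k \<ge> 2 \<Longrightarrow> b \<ge> 2 \<Longrightarrow> thesis"
        "\<And>n k. a = n + k + 1 \<Longrightarrow> b = n - k \<Longrightarrow> k \<ge> 1 \<Longrightarrow> b \<ge> 2 \<Longrightarrow> thesis"
      define k where "k = (a - b) div 2"
      have "a - b = 2 * k \<or> a - b = 2 * k + 1" unfolding k_def by presburger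
      then show thesis
        using c(1-4) c(5)[of "b + k" k] c(6)[of "b + k" k] ab by smt
    qed
    then show ?thesis
    proof cases
      case 1
      then show ?thesis by (simp add: w_def parity_weight_def power2_eq_square)
    next
      case 2
      then show ?thesis by (simp add: w_def parity_weight_def)
    next
      case 3
      then show ?thesis using Iodd[of b] by (simp add: algebra_simps)
    next
      case 4
      have "w a b = 1" "w b a = 1" using 4 by (auto simp: w_def parity_weight_def)
      moreover have "a + b = 2 * (b + 1)" "a - b = 2" "b + 1 + 2 = a + 1" "b + 1 - 1 = b" "b + 1 + 1 = a"
        "b + 1 - 2 = b - 1" "a - 1 = b + 1"
        using 4 by auto
      ultimately show ?thesis using Heven[of "b + 1"] 4(1)
        by (simp add: power2_eq_square ac_simps)
    next
      case 5
      have c: "k \<ge> 2" "n - k \<ge> 2" "2 * n \<le> int N" using 5 ab by auto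
      \<comment> \<open>transformed to \<open>(n + 1/2, n - 1/2, k + 1/2, k - 1/2)\<close>\<close>
      have w1: "w a b = 1" "w b a = 1" using 5 by (auto simp: w_def parity_weight_def)
      have e: "g (2 * n) = (g (n + 2) * g (n - 1)) * (g n * g (n - 1))
          - (g (n + 1) * g n) * (g (n + 1) * g (n - 2))"
        using Heven[of n] c by simp
      have e': "g (2 * k) = (g (k + 2) * g (k - 1)) * (g k * g (k - 1))
          - (g (k + 1) * g k) * (g (k + 1) * g (k - 2))"
        unfolding 5(1,2) using H[of "k - 1" k] c by (simp add: algebra_simps)
      have e2: "g (a + 1) * g b = (g (n + 2) * g (n - 1)) * (g (k + 1) * g k)
        - (g (n + 1) * g n) * (g (k + 2) * g (k - 1))"
        unfolding 5(1,2) using H[of k n] c by (simp add: algebra_simps)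
      have e3: "g (a - 1) * g b = (g (n + 1) * g (n - 2)) * (g k * g (k - 1)) - (g n * g (n - 1)) * (g (k + 1) * g (k - 2))"
        unfolding 5(1,2) using H[of "k - 1" "n - 1"] c by (simp add: algebra_simps)
      have e4: "g a * g (b + 1) = (g (n + 2) * g (n - 1)) * (g k * g (k - 1))
        - (g (n + 1) * g n) * (g (k + 1) * g (k - 2))"
        unfolding 5(1,2) using H[of "k - 1" n] c by (simp add: algebra_simps)
      have e5: "g a * g (b - 1) = (g (n + 1) * g (n - 2)) * (g (k + 1) * g k) - (g n * g (n - 1)) * (g (k + 2) * g (k - 1))"
        unfolding 5(1,2) using H[of k "n - 1"] c by (simp add: algebra_simps)
      \<comment> \<open>All six products are now minors of the columns with entries
        \<open>g (x + 2) * g (x - 1)\<close> and \<open>g (x + 1) * g x\<close>, for x = n, n-1, k,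
        k-1; this is their Pluecker identity.\<close>
      have "g (2 * n) * g (2 * k) = (g (a + 1) * g b) * (g (a - 1) * g b) - (g a * g (b + 1)) * (g a * g (b - 1))"
        unfolding e e' e2 e3 e4 e5 by algebra
      moreover have "a + b = 2 * n" "a - b = 2 * k" using 5 by auto
      ultimately show ?thesis by (simp add: w1 power2_eq_square mult_ac)
    next
      case 6
      \<comment> \<open>transformed to \<open>(n + 1, n, k + 1, k)\<close>\<close>
      have c: "k \<ge> 1" "n - k \<ge> 2" "2 * n + 1 \<le> int N" using 6 ab by auto
      define p where "p = (\<lambda>x. g (x + 1) * g (x - 1))"
      have e: "g (2 * n + 1) =
          w (n + 1) n * p (n + 1) * (g n)^2 - w n (n + 1) * (g (n + 1))^2 * p n"
        using Iodd[of n] c by (simp add: p_def algebra_simps)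
      have e': "g (2 * k + 1) =
          w (k + 1) k * p (k + 1) * (g k)^2 - w k (k + 1) * (g (k + 1))^2 * p k"
        unfolding 6(1,2) using I[of k "k + 1"] c by (simp add: p_def algebra_simps)
      have e2: "g (a + 1) * g b = w (n + 1) (k + 1) * p (n + 1) * (g (k + 1))^2
            - w (k + 1) (n + 1) * (g (n + 1))^2 * p (k + 1)"
        unfolding 6(1,2) using I[of "k + 1" "n + 1"] c by (simp add: p_def algebra_simps)
      have e3: "g (a - 1) * g b = w n k * p n * (g k)^2 - w k n * (g n)^2 * p k"
        unfolding 6(1,2) using I[of k n] c by (simp add: p_def algebra_simps)
      have e4: "g a * g (b + 1) = w (n + 1) k * p (n + 1) * (g k)^2 - w k (n + 1) * (g (n + 1))^2 * p k"
        unfolding 6(1,2) using I[of k "n + 1"] c by (simp add: p_def algebra_simps)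
      have e5: "g a * g (b - 1) = w n (k + 1) * p n * (g (k + 1))^2 - w (k + 1) n * (g n)^2 * p (k + 1)"
        unfolding 6(1,2) using I[of "k + 1" n] c by (simp add: p_def algebra_simps)
      \<comment> \<open>The weights depend only on parities, so fixing those of n and k leaves
        polynomial identities.\<close>
      have "g (2 * n + 1) * g (2 * k + 1) = w a b * (g (a + 1) * g b) * (g (a - 1) * g b)
           - w b a * (g a * g (b + 1)) * (g a * g (b - 1))"
        unfolding e e' e2 e3 e4 e5
        by (cases "even n"; cases "even k") (simp_all add: w_def parity_weight_def 6(1,2) algebra_simps)
      moreover have "a + b = 2 * n + 1" "a - b = 2 * k + 1" using 6 by auto
      ultimately show ?thesis by (simp add: power2_eq_square mult_ac)
    qed
  qed
  have "g (i + j + 1) * g (i - j) =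
      (g (i + 2) * g (i - 1)) * (g (j + 1) * g j) - (g (i + 1) * g i) * (g (j + 2) * g (j - 1))"
    if ij: "0 \<le> j" "j < i" "i + j + 1 = int N" for i j
  proof -
    consider "j = 0" | "j = 1" | "j \<ge> 2" "i = j + 1"
      | n k where "i = n + k" "j = n - k" "k \<ge> 1" "j \<ge> 2"
      | n k where "i = n + k" "j = n - k - 1" "k \<ge> 1" "j \<ge> 2"
    proof -
      assume c: "j = 0 \<Longrightarrow> thesis" "j = 1 \<Longrightarrow> thesis" "j \<ge> 2 \<Longrightarrow> i = j + 1 \<Longrightarrow> thesis"
        "\<And>n k. i = n + k \<Longrightarrow> j = n - k \<Longrightarrow> k \<ge> 1 \<Longrightarrow> j \<ge> 2 \<Longrightarrow> thesis"
        "\<And>n k. i = n + k \<Longrightarrow> j = n - k - 1 \<Longrightarrow> k \<ge> 1 \<Longrightarrow> j \<ge> 2 \<Longrightarrow> thesis"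
      define k where "k = (i - j) div 2"
      have "i - j = 2 * k \<or> i - j = 2 * k + 1" unfolding k_def by presburger
      then show thesis
        using c(1-3) c(4)[of "j + k" k] c(5)[of "j + k + 1" k] ij by smt
    qed
    then show ?thesis
    proof cases
      case 1
      then show ?thesis by simp
    next
      case 2
      then show ?thesis by (simp add: algebra_simps)
    next
      case 3
      then show ?thesis using Heven[of "j + 1"] by (simp add: algebra_simps)
    next
      case 4
      \<comment> \<open>transformed to \<open>(n + 1, n, k + 1, k - 1)\<close>\<close>
      have c: "k \<ge> 1" "n - k \<ge> 2" "2 * n + 1 \<le> int N" using 4 ij by auto
      define p where "p = (\<lambda>x. g (x + 1) * g (x - 1))"
      have e: "g (2 * n + 1) =
          w (n + 1) n * p (n + 1) * (g n)^2 - w n (n + 1) * (g (n + 1))^2 * p n"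
        using Iodd[of n] c by (simp add: p_def algebra_simps)
      \<comment> \<open>The entries k+1 and k-1 differ by 2, so the second factor is
        \<open>g 2 = 1\<close>.\<close>
      have e': "g (2 * k) = w (k + 1) (k - 1) * p (k + 1) * (g (k - 1))^2
          - w (k - 1) (k + 1) * (g (k + 1))^2 * p (k - 1)"
        unfolding 4(1,2) using I[of "k - 1" "k + 1"] c by (simp add: p_def algebra_simps)
      have e2: "g (i + 2) * g j = w (n + 1) (k + 1) * p (n + 1) * (g (k + 1))^2
            - w (k + 1) (n + 1) * (g (n + 1))^2 * p (k + 1)"
        unfolding 4(1,2) using I[of "k + 1" "n + 1"] c by (simp add: p_def algebra_simps)
      have e3: "g (i - 1) * g (j + 1) = w n (k - 1) * p n * (g (k - 1))^2 - w (k - 1) n * (g n)^2 * p (k - 1)"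
        unfolding 4(1,2) using I[of "k - 1" n] c by (simp add: p_def algebra_simps)
      have e4: "g i * g (j + 2) = w (n + 1) (k - 1) * p (n + 1) * (g (k - 1))^2
        - w (k - 1) (n + 1) * (g (n + 1))^2 * p (k - 1)"
        unfolding 4(1,2) using I[of "k - 1" "n + 1"] c by (simp add: p_def algebra_simps)
      have e5: "g (i + 1) * g (j - 1) = w n (k + 1) * p n * (g (k + 1))^2 - w (k + 1) n * (g n)^2 * p (k + 1)"
        unfolding 4(1,2) using I[of "k + 1" n] c by (simp add: p_def algebra_simps)
      have "g (2 * n + 1) * g (2 * k) = (g (i + 2) * g j) * (g (i - 1) * g (j + 1))
           - (g i * g (j + 2)) * (g (i + 1) * g (j - 1))"
        unfolding e e' e2 e3 e4 e5
        by (cases "even n"; cases "even k") (simp_all add: w_def parity_weight_def algebra_simps)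
      moreover have "i + j + 1 = 2 * n + 1" "i - j = 2 * k" using 4 by auto
      ultimately show ?thesis by (simp add: mult_ac)
    next
      case 5
      \<comment> \<open>transformed to \<open>(n + 1/2, n - 1/2, k + 3/2, k - 1/2)\<close>\<close>
      have c: "k \<ge> 1" "n - k - 1 \<ge> 2" "2 * n \<le> int N" using 5 ij by auto
      have e: "g (2 * n) = (g (n + 2) * g (n - 1)) * (g n * g (n - 1))
          - (g (n + 1) * g n) * (g (n + 1) * g (n - 2))"
        using Heven[of n] c by simp
      have e': "g (2 * k + 1) = (g (k + 3) * g k) * (g k * g (k - 1))
          - (g (k + 2) * g (k + 1)) * (g (k + 1) * g (k - 2))"
        unfolding 5(1,2) using H[of "k - 1" "k + 1"] c by (simp add: algebra_simps)
      have e2: "g (i + 2) * g j = (g (n + 2) * g (n - 1)) * (g (k + 2) * g (k + 1))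
        - (g (n + 1) * g n) * (g (k + 3) * g k)"
        unfolding 5(1,2) using H[of "k + 1" n] c by (simp add: algebra_simps)
      have e3: "g (i - 1) * g (j + 1) = (g (n + 1) * g (n - 2)) * (g k * g (k - 1)) - (g n * g (n - 1)) * (g (k + 1) * g (k - 2))"
        unfolding 5(1,2) using H[of "k - 1" "n - 1"] c by (simp add: algebra_simps)
      have e4: "g i * g (j + 2) = (g (n + 2) * g (n - 1)) * (g k * g (k - 1))
        - (g (n + 1) * g n) * (g (k + 1) * g (k - 2))"
        unfolding 5(1,2) using H[of "k - 1" n] c by (simp add: algebra_simps)
      have e5: "g (i + 1) * g (j - 1) = (g (n + 1) * g (n - 2)) * (g (k + 2) * g (k + 1)) - (g n * g (n - 1)) * (g (k + 3) * g k)"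
        unfolding 5(1,2) using H[of "k + 1" "n - 1"] c by (simp add: algebra_simps)
      have "g (2 * n) * g (2 * k + 1) = (g (i + 2) * g j) * (g (i - 1) * g (j + 1)) - (g i * g (j + 2)) * (g (i + 1) * g (j - 1))"
        unfolding e e' e2 e3 e4 e5 by algebra
      moreover have "i + j + 1 = 2 * n" "i - j = 2 * k + 1" using 5 by auto
      ultimately show ?thesis by (simp add: mult_ac)
    qed
  qed
  with A show ?case by auto
qed

text \<open>Restoring the factors B absorbs the weights and gives the shape required by
  \<open>ellipticI\<close>. It only multiplies by powers of B, so B = 0 is covered.\<close>

lemma EDS_bilinear:
  assumes "0 \<le> b" "b < a"
  shows "EDS B C D (a + b) * EDS B C D (a - b) =
    (EDS B C D (a + 1) * EDS B C D (a - 1)) * (EDS B C D b)^2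
    - (EDS B C D a)^2 * (EDS B C D (b + 1) * EDS B C D (b - 1))"
proof -
  define g where "g = eds_tilde B C D"
  have *: "g (a + b) * g (a - b) =
      parity_weight B a b * (g (a + 1) * g (a - 1)) * (g b)^2
       - parity_weight B b a * (g a)^2 * (g (b + 1) * g (b - 1))"
    using eds_tilde_bilinear[of "nat (a + b)" B C D] assms unfolding g_def by blast
  have "EDS B C D (a + b) * EDS B C D (a - b) =
      (if even (a + b) then B^2 else 1) * (g (a + b) * g (a - b))"
    by (simp add: EDS_def power2_eq_square flip: g_def)
  then show ?thesis
    unfolding *
    by (cases "even a"; cases "even b")
      (simp_all add: EDS_def parity_weight_def power2_eq_square power4_eq_xxxx algebra_simps flip: g_def)
qed


section \<open>Dilations\<close>

text \<open>P and Q are dilated along with g. The danger is that r divides a+b and a-b but not both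
  a and b. For odd r this is impossible; for even r a nonzero product forces both quotients to be
  odd, so their sum and difference can be halved.\<close>

lemma elliptic_dilate:
  fixes g P Q :: "int \<Rightarrow> 'a::field"
  assumes r: "r > 0" and par: "odd r \<or> (\<forall>n. even n \<longrightarrow> g n = 0)"
    and g: "\<And>a b. 0 \<le> b \<Longrightarrow> b < a \<Longrightarrow> g (a + b) * g (a - b) = P a * Q b - Q a * P b"
  shows "elliptic (\<lambda>n. A * dilate r g n)"
proof (rule ellipticI[where P = "\<lambda>n. A^2 * dilate r P n" and Q = "dilate r Q"])
  fix a b :: int
  assume ab: "0 \<le> b" "b < a"
  show "A * dilate r g (a + b) * (A * dilate r g (a - b)) =
      A^2 * dilate r P a * dilate r Q b - dilate r Q a * (A^2 * dilate r P b)"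
  proof (cases "r dvd a \<and> r dvd b")
    case True
    then obtain a' b' where e: "a = r * a'" "b = r * b'" by (auto elim!: dvdE)
    have "0 \<le> b'" "b' < a'" using ab r unfolding e by (auto simp: zero_le_mult_iff)
    moreover have "a + b = r * (a' + b')" "a - b = r * (a' - b')" unfolding e by algebra+
    ultimately show ?thesis using g[of b' a'] r unfolding dilate_def
      by (simp add: e) algebra
  next
    case False
    have "dilate r g (a + b) * dilate r g (a - b) = 0"
    proof (rule ccontr)
      assume "\<not> ?thesis"
      then obtain u v where uv: "a + b = r * u" "a - b = r * v" "g u \<noteq> 0" "g v \<noteq> 0"
        by (auto simp: dilate_def split: if_splits) (metis dvd_mult_div_cancel)
      have 2: "2 * a = r * (u + v)" "2 * b = r * (u - v)" using uv(1,2) by (simp_all add: algebra_simps)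
      have "r dvd a \<and> r dvd b"
      proof (cases "odd r")
        case True
        then have "coprime r 2" by simp
        moreover have "r dvd 2 * a" "r dvd 2 * b" unfolding 2 by simp_all
        ultimately show ?thesis using coprime_dvd_mult_right_iff by blast
      next
        case False
        then have "odd u" "odd v" using par uv by auto
        then obtain x y where "u + v = 2 * x" "u - v = 2 * y" by (metis dvdE even_add even_diff)
        then have "a = r * x" "b = r * y" using 2 by auto
        then show ?thesis by simp
      qed
      with False show False by simp
    qed
    moreover have "dilate r P a * dilate r Q b = 0" "dilate r Q a * dilate r P b = 0"
      using False by (auto simp: dilate_def)
    ultimately show ?thesis by algebra
  qed
qed

lemma elliptic_dilate_EDS:
  assumes "r > 0" "odd r \<or> B = 0"
  shows "elliptic (\<lambda>n. A * dilate r (EDS B C D) n)"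
proof (rule elliptic_dilate)
  show "odd r \<or> (\<forall>n. even n \<longrightarrow> EDS B C D n = 0)" using assms(2) by (auto simp: EDS_def)
qed (rule assms(1), erule (1) EDS_bilinear)

section \<open>The sequences ES\<close>

text \<open>Triangular numbers indexed so that both exponents in ES are values at k and k+1. The
  integer is never negative, so \<open>nat\<close> loses nothing.\<close>

definition triangular :: "int \<Rightarrow> nat" where
  "triangular k = nat (k * (k - 1) div 2)"

lemma triangular_add:
  assumes "i * (i - 1) + j * (j - 1) = 2 * e"
  shows "triangular i + triangular j = nat e"
proof -
  have nonneg: "k * (k - 1) \<ge> 0" for k :: int
    by (cases "k \<le> 0") (auto simp: zero_le_mult_iff)
  obtain x y where xy: "i * (i - 1) = 2 * x" "j * (j - 1) = 2 * y"
    using that[of "i * (i - 1) div 2" "j * (j - 1) div 2"] by simp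
  have "x \<ge> 0" "y \<ge> 0" "e = x + y" using nonneg[of i] nonneg[of j] assms xy by auto
  then show ?thesis by (simp add: triangular_def xy nat_add_distrib)
qed

lemma ES_triangular:
  assumes "0 < r" "r < s"
  shows "ES r s B D (k * (r + s) + r) = B ^ triangular k * D ^ triangular (k + 1)"
    and "ES r s B D (k * (r + s) - r) = - (B ^ triangular (k + 1) * D ^ triangular k)"
  using assms by (simp_all add: ES_plus ES_minus triangular_def mult.commute)

text \<open>Modulo the odd number q = r+s, both a+b and a-b can be congruent to r or -r only if one
  of a, b is 0 and the other r or -r. If b is the multiple of q the two signs in ES agree, otherwise
  they differ; hence the two terms of the product formula.\<close>

lemma elliptic_ES:
  fixes A B D :: "'a::field"
  assumes rs: "0 < r" "r < s" "even r \<longleftrightarrow> odd s"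
  shows "elliptic (\<lambda>n. A * ES r s B D n)"
proof -
  define q where "q = r + s"
  have q: "q > 0" "odd q" "r < q" "2 * r < q" using rs by (auto simp: q_def)
  \<comment> \<open>These are well chosen because the exponents of \<open>B\<close> and \<open>D\<close> in
    \<open>ES (u * q + (v * q + r)) * ES (u * q - (v * q + r))\<close> split into a part depending on \<open>u\<close> and a part depending on \<open>v\<close>.\<close>
  define \<alpha> where "\<alpha> x = (if q dvd x then (B * D) ^ nat ((x div q)^2) else 0)" for x
  define \<gamma> where "\<gamma> z =
    (if q dvd z - r then let v = (z - r) div q in B ^ nat (v^2 - v) * D ^ nat (v^2 + v)
     else if q dvd z + r then let v = (z + r) div q in B ^ nat (v^2 + v) * D ^ nat (v^2 - v)
     else 0)" for z
  have nd: "\<not> q dvd r" "\<not> q dvd 2 * r" using q rs by (auto dest: zdvd_imp_le)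
  have sh: "q dvd u * q + x \<longleftrightarrow> q dvd x" "q dvd u * q - x \<longleftrightarrow> q dvd x" for u x
    using dvd_add_right_iff[of q "u * q"] dvd_diff_right_iff[of q "u * q" x] by auto
  have \<alpha>: "\<alpha> (u * q) = (B * D) ^ nat (u^2)" for u
    using q by (simp add: \<alpha>_def)
  have \<gamma>1: "\<gamma> (v * q + r) = B ^ nat (v^2 - v) * D ^ nat (v^2 + v)" for v
    using q by (simp add: \<gamma>_def)
  have "\<not> q dvd v * q - r - r" for v using nd(2) sh(2)[of v "2 * r"] by (simp add: algebra_simps)
  then have \<gamma>2: "\<gamma> (v * q - r) = B ^ nat (v^2 + v) * D ^ nat (v^2 - v)" for v
    using q by (simp add: \<gamma>_def)
  have \<gamma>0: "\<gamma> (u * q) = 0" for u using nd sh by (simp add: \<gamma>_def)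
  have \<alpha>0: "\<alpha> (u * q + r) = 0" "\<alpha> (u * q - r) = 0" for u using nd sh by (simp_all add: \<alpha>_def)
  have ES: "ES r s B D (k * q + r) = B ^ triangular k * D ^ triangular (k + 1)"
      "ES r s B D (k * q - r) = - (B ^ triangular (k + 1) * D ^ triangular k)" for k
    using ES_triangular[OF rs(1,2)] by (simp_all add: q_def)
  have nn: "0 \<le> v^2 - v" "0 \<le> v^2 + v" for v :: int
  proof -
    have "0 \<le> v * (v - 1)" "0 \<le> v * (v + 1)"
      by (cases "v \<le> 0"; auto simp: zero_le_mult_iff)+
    then show "0 \<le> v^2 - v" "0 \<le> v^2 + v" by (simp_all add: power2_eq_square algebra_simps)
  qed
  have mult: "\<exists>u. x = u * q" if "q dvd x" for x
    using that by (auto simp: mult.commute)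
  have plus: "\<exists>v. x = v * q + r" if "q dvd x - r" for x
    using mult[OF that] by (metis diff_add_cancel)
  have minus: "\<exists>v. x = v * q - r" if "q dvd x + r" for x
    using mult[OF that] by (metis add_diff_cancel_right')
  have tri: "triangular i + triangular j = nat (u^2) + nat w"
    if "i * (i - 1) + j * (j - 1) = 2 * (u^2 + w)" "0 \<le> w" for i j u w
    using triangular_add[OF that(1)] that(2) by (simp add: nat_add_distrib)
  have comb: "B ^ i * D ^ k * (B ^ j * D ^ l) = (B * D) ^ x * (B ^ y * D ^ z)"
      "B ^ i * D ^ k * (B ^ j * D ^ l) = B ^ y * D ^ z * (B * D) ^ x"
    if "i + j = x + y" "k + l = x + z" for i j k l x y z
  proof -
    have "B ^ i * D ^ k * (B ^ j * D ^ l) = B ^ (i + j) * D ^ (k + l)"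
      by (simp add: power_add mult_ac)
    then show "B ^ i * D ^ k * (B ^ j * D ^ l) = (B * D) ^ x * (B ^ y * D ^ z)"
      by (simp add: that power_add power_mult_distrib mult_ac)
    then show "B ^ i * D ^ k * (B ^ j * D ^ l) = B ^ y * D ^ z * (B * D) ^ x"
      by (simp add: mult.commute)
  qed
  have mult: "\<exists>u. x = u * q" if "q dvd x" for x
    using that by (auto simp: mult.commute)
  have plus: "\<exists>v. x = v * q + r" if "q dvd x - r" for x
    using mult[OF that] by (metis diff_add_cancel)
  have minus: "\<exists>v. x = v * q - r" if "q dvd x + r" for x
    using mult[OF that] by (metis add_diff_cancel_right')
  have nat_split: "nat (u^2 + (v^2 - v)) = nat (u^2) + nat (v^2 - v)"
    "nat (u^2 + (v^2 + v)) = nat (u^2) + nat (v^2 + v)" for u v :: int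
    by (rule nat_add_distrib; simp add: nn del: diff_ge_0_iff_ge)+
  have bil: "ES r s B D (a + b) * ES r s B D (a - b) = \<gamma> a * \<alpha> b - \<alpha> a * \<gamma> b" for a b
  proof -
    consider u v where "a = u * q" "b = v * q + r" | u v where "a = u * q" "b = v * q - r"
      | u v where "a = v * q + r" "b = u * q" | u v where "a = v * q - r" "b = u * q"
      | "\<not> (q dvd a \<and> (q dvd b - r \<or> q dvd b + r))" "\<not> (q dvd b \<and> (q dvd a - r \<or> q dvd a + r))"
      using mult plus minus by meson
    then show ?thesis
    proof cases
      case 1
      have "triangular (u + v) + triangular (u - v + 1) = nat (u^2) + nat (v^2 - v)"
        "triangular (u + v + 1) + triangular (u - v) = nat (u^2) + nat (v^2 + v)"
        by (rule tri, algebra, rule nn)+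
      moreover have "a + b = (u + v) * q + r" "a - b = (u - v) * q - r" using 1 by algebra+
      ultimately show ?thesis unfolding \<open>a + b = _\<close> \<open>a - b = _\<close> ES
        unfolding 1 \<alpha> \<gamma>0 \<alpha>0 \<gamma>1
        by (simp add: comb)
    next
      case 2
      have "triangular (u + v + 1) + triangular (u - v) = nat (u^2) + nat (v^2 + v)"
        "triangular (u + v) + triangular (u - v + 1) = nat (u^2) + nat (v^2 - v)"
        by (rule tri, algebra, rule nn)+
      moreover have "a + b = (u + v) * q - r" "a - b = (u - v) * q + r" using 2 by algebra+
      ultimately show ?thesis unfolding \<open>a + b = _\<close> \<open>a - b = _\<close> ES
        unfolding 2 \<alpha> \<gamma>0 \<alpha>0 \<gamma>2
        by (simp add: comb)
    next
      case 3
      have "triangular (v + u) + triangular (v - u) = nat (u^2) + nat (v^2 - v)"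
        "triangular (v + u + 1) + triangular (v - u + 1) = nat (u^2) + nat (v^2 + v)"
        by (rule tri, algebra, rule nn)+
      moreover have "a + b = (v + u) * q + r" "a - b = (v - u) * q + r" using 3 by algebra+
      ultimately show ?thesis unfolding \<open>a + b = _\<close> \<open>a - b = _\<close> ES
        unfolding 3 \<alpha> \<gamma>0 \<alpha>0 \<gamma>1
        by (simp add: comb)
    next
      case 4
      have "triangular (v + u + 1) + triangular (v - u + 1) = nat (u^2) + nat (v^2 + v)"
        "triangular (v + u) + triangular (v - u) = nat (u^2) + nat (v^2 - v)"
        by (rule tri, algebra, rule nn)+
      moreover have "a + b = (v + u) * q - r" "a - b = (v - u) * q - r" using 4 by algebra+
      ultimately show ?thesis unfolding \<open>a + b = _\<close> \<open>a - b = _\<close> ES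
        unfolding 4 \<alpha> \<gamma>0 \<alpha>0 \<gamma>2
        by (simp add: comb)
    next
      case 5
      have "\<gamma> a * \<alpha> b = 0" "\<alpha> a * \<gamma> b = 0" using 5 by (auto simp: \<alpha>_def \<gamma>_def)
      moreover have "ES r s B D (a + b) * ES r s B D (a - b) = 0"
      \<comment> \<open>Adding or subtracting the two divisibilities gives q dvd 2a or q dvd 2b, and
        q is odd.\<close>
      proof (rule ccontr)
        assume "\<not> ?thesis"
        then have "q dvd (a + b) - r \<or> q dvd (a + b) + r" "q dvd (a - b) - r \<or> q dvd (a - b) + r"
          by (auto simp: ES_def q_def split: if_splits)
        then consider "q dvd (a + b) - r" "q dvd (a - b) - r" | "q dvd (a + b) - r" "q dvd (a - b) + r"
          | "q dvd (a + b) + r" "q dvd (a - b) - r" | "q dvd (a + b) + r" "q dvd (a - b) + r" by blast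
        then show False
        proof cases
          case 1
          from dvd_diff[OF 1] have "q dvd 2 * b" by simp
          then have "q dvd b" using q by (simp add: coprime_dvd_mult_right_iff)
          moreover from 1(1) this have "q dvd a - r"
            by (metis add_diff_cancel_right' add_diff_eq diff_add_eq dvd_diff)
          ultimately show False using 5 by blast
        next
          case 2
          from dvd_add[OF 2] have "q dvd 2 * a" by simp
          then have "q dvd a" using q by (simp add: coprime_dvd_mult_right_iff)
          moreover from 2(1) this have "q dvd b - r"
            using dvd_diff[OF 2(1) \<open>q dvd a\<close>] by (simp add: algebra_simps)
          ultimately show False using 5 by blast
        next
          case 3
          from dvd_add[OF 3] have "q dvd 2 * a" by simp
          then have "q dvd a" using q by (simp add: coprime_dvd_mult_right_iff)
          moreover from this have "q dvd b + r"
            using dvd_diff[OF 3(1) \<open>q dvd a\<close>] by (simp add: algebra_simps)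
          ultimately show False using 5 by blast
        next
          case 4
          from dvd_diff[OF 4] have "q dvd 2 * b" by simp
          then have "q dvd b" using q by (simp add: coprime_dvd_mult_right_iff)
          moreover from this have "q dvd a + r"
            using dvd_diff[OF 4(1) \<open>q dvd b\<close>] by (simp add: algebra_simps)
          ultimately show False using 5 by blast
        qed
      qed
      ultimately show ?thesis by (simp only: diff_zero)
    qed
  qed
  show ?thesis
  proof (rule ellipticI[where P = "\<lambda>n. A^2 * \<gamma> n" and Q = \<alpha>])
    show "A * ES r s B D (a + b) * (A * ES r s B D (a - b)) =
        A^2 * \<gamma> a * \<alpha> b - \<alpha> a * (A^2 * \<gamma> b)" for a b
      using bil[of a b] by algebra
  qed
qed

section \<open>Weak ellipticity and determination by initial values\<close>

text \<open>The elliptic relation for (m, n, r, 0), which is the hypothesis of the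
  classification.\<close>

definition weakly_elliptic :: "(int \<Rightarrow> 'a::field) \<Rightarrow> bool" where
  "weakly_elliptic h \<longleftrightarrow> (\<forall>m n r. m > n \<and> n > r \<and> r > 0 \<longrightarrow>
     h (m + n) * h (m - n) * (h r)^2 =
       h (m + r) * h (m - r) * (h n)^2 - h (n + r) * h (n - r) * (h m)^2)"

lemma weakly_ellipticD:
  assumes "weakly_elliptic h" "m > n" "n > r" "r > 0"
  shows "h (m + n) * h (m - n) * (h r)^2 =
       h (m + r) * h (m - r) * (h n)^2 - h (n + r) * h (n - r) * (h m)^2"
  using assms unfolding weakly_elliptic_def by blast

lemma elliptic_imp_weakly_elliptic:
  assumes "elliptic h"
  shows "weakly_elliptic h"
  unfolding weakly_elliptic_def
proof (intro allI impI)
  fix m n r :: int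
  assume "m > n \<and> n > r \<and> r > 0"
  then have "h (m + n) * h (m - n) * h (r + 0) * h (r - 0) =
      h (m + r) * h (m - r) * h (n + 0) * h (n - 0) - h (n + r) * h (n - r) * h (m + 0) * h (m - 0)"
    using assms[unfolded elliptic_def, rule_format, of n m r 0] by blast
  then show "h (m + n) * h (m - n) * (h r)^2 =
       h (m + r) * h (m - r) * (h n)^2 - h (n + r) * h (n - r) * (h m)^2"
    by (simp add: power2_eq_square mult.assoc)
qed

text \<open>The relation for (k+t, k, r) determines h(2k+t) h(t) h(r)^2 from smaller indices once k
  > r. Taking t = r handles indices of the parity of r beyond 3r, and t = s the others beyond
  s+2r.\<close>

lemma weakly_elliptic_eqI:
  fixes h g :: "int \<Rightarrow> 'a::field"
  assumes h: "weakly_elliptic h" and g: "weakly_elliptic g"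
    and r: "r > 0" "h r \<noteq> 0"
    and same: "\<And>n. 0 < n \<Longrightarrow> n \<le> 3 * r \<Longrightarrow> even (n - r) \<Longrightarrow> h n = g n"
    and opp: "(\<forall>n>0. odd (n - r) \<longrightarrow> h n = g n) \<or>
      (\<exists>s>0. odd (s - r) \<and> h s \<noteq> 0 \<and> (\<forall>n. 0 < n \<and> n \<le> s + 2 * r \<and> odd (n - r) \<longrightarrow> h n = g n))"
    and n: "n > 0"
  shows "h n = g n"
proof -
  have "n = int k \<Longrightarrow> h n = g n" for k
    using n
  proof (induction k arbitrary: n rule: less_induct)
    case (less k)
    have IH: "h i = g i" if "0 < i" "i < n" for i
      using less.IH[of "nat i" i] that less.prems by auto
    have step: "h n = g n" if t: "t > 0" "h t \<noteq> 0" "even (n - t)" "n > t + 2 * r" for t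
    proof -
      obtain k where "n - t = 2 * k" using t(3) by (rule evenE)
      then have n: "n = 2 * k + t" and k: "k > r" using t by auto
      have eq: "h r = g r" "h t = g t" "h (k + t + r) = g (k + t + r)"
        "h (k + t - r) = g (k + t - r)" "h k = g k" "h (k + r) = g (k + r)"
        "h (k - r) = g (k - r)" "h (k + t) = g (k + t)"
        using n k t r by (intro IH; linarith)+
      have "h (k + t + k) * h (k + t - k) * (h r)^2 = g (k + t + k) * g (k + t - k) * (g r)^2"
        using weakly_ellipticD[OF h, of k "k + t" r] weakly_ellipticD[OF g, of k "k + t" r] k t r
        by (simp only: eq less_add_same_cancel1)
      moreover have "k + t + k = n" "k + t - k = t" using n by auto
      ultimately have "h n * h t * (h r)^2 = g n * h t * (h r)^2" using eq by simp
      then show ?thesis using t r by simp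
    qed
    show ?case
    proof (cases "even (n - r)")
      case True
      then show ?thesis using same[of n] step[of r] r less.prems by (cases "n \<le> 3 * r") auto
    next
      case False
      from opp show ?thesis
      proof
        assume "\<exists>s>0. odd (s - r) \<and> h s \<noteq> 0 \<and> (\<forall>n. 0 < n \<and> n \<le> s + 2 * r \<and> odd (n - r) \<longrightarrow> h n = g n)"
        then obtain s where s: "s > 0" "odd (s - r)" "h s \<noteq> 0"
          "\<And>n. 0 < n \<Longrightarrow> n \<le> s + 2 * r \<Longrightarrow> odd (n - r) \<Longrightarrow> h n = g n" by blast
        have "even (n - s)" using s False by auto
        then show ?thesis using s(4)[of n] step[of s] s(1,3) False less.prems
          by (cases "n \<le> s + 2 * r") auto
      qed (use False less.prems in auto)
    qed
  qed
  from this[of "nat n"] n show ?thesis by simp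
qed

section \<open>Classification\<close>

lemma int_least:
  assumes "(n::int) > 0" "P n"
  obtains r where "r > 0" "P r" "\<And>m. 0 < m \<Longrightarrow> m < r \<Longrightarrow> \<not> P m"
proof -
  define Q where "Q k \<longleftrightarrow> k > 0 \<and> P (int k)" for k
  have "Q (nat n)" using assms by (simp add: Q_def)
  then have "Q (LEAST k. Q k)" by (rule LeastI)
  moreover have "\<not> P m" if "0 < m" "m < int (LEAST k. Q k)" for m
    using not_less_Least[of "nat m" Q] that by (auto simp: Q_def)
  ultimately show thesis using that[of "int (LEAST k. Q k)"] by (auto simp: Q_def)
qed

text \<open>As r+s is odd, k has the parity of n-r. So the even case starts with r (k = 0) and next
  2s+r > 3r (k = 2), while the odd case has s and s+2r (k = 1) before 3s+2r (k = 3).\<close>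

lemma ES_support:
  assumes rs: "0 < r" "r < s" "even r \<longleftrightarrow> odd s" and n: "n > 0" "ES r s B D n \<noteq> 0"
  shows "even (n - r) \<Longrightarrow> n \<le> 3 * r \<Longrightarrow> n = r"
    and "odd (n - r) \<Longrightarrow> n \<le> s + 2 * r \<Longrightarrow> n = s \<or> n = s + 2 * r"
proof -
  have "(r + s) dvd (n + r) \<or> (r + s) dvd (n - r)"
    using n(2) by (auto simp: ES_def split: if_splits)
  then obtain k where "n + r = (r + s) * k \<or> n - r = (r + s) * k" by (auto simp: dvd_def)
  then have k: "n = k * (r + s) - r \<or> n = k * (r + s) + r"
    by (auto simp: mult.commute[of k])
  have "k < 0 \<Longrightarrow> k * (r + s) \<le> - (r + s)" "k \<ge> 2 \<Longrightarrow> k * (r + s) \<ge> 2 * (r + s)"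
    "k \<ge> 3 \<Longrightarrow> k * (r + s) \<ge> 3 * (r + s)"
    using rs mult_right_mono[of k "-1" "r + s"] mult_right_mono[of 2 k "r + s"]
      mult_right_mono[of 3 k "r + s"] by auto
  then consider "k = 0" | "k = 1" | "k = 2" | "k \<ge> 3" "n \<ge> 3 * (r + s) - r"
    using k n(1) rs by fastforce
  note c = this
  show "even (n - r) \<Longrightarrow> n \<le> 3 * r \<Longrightarrow> n = r"
    by (cases rule: c) (use k n(1) rs in auto)
  show "odd (n - r) \<Longrightarrow> n \<le> s + 2 * r \<Longrightarrow> n = s \<or> n = s + 2 * r"
    by (cases rule: c) (use k n(1) rs in auto)
qed

lemma multiple_le_four_cases:
  assumes "(r::int) > 0" "r dvd n" "0 < n" "n \<le> 4 * r"
  shows "n = r \<or> n = 2 * r \<or> n = 3 * r \<or> n = 4 * r"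
proof -
  obtain k where k: "n = r * k" using assms(2) by blast
  with assms have "0 < k" "k \<le> 4" by (auto simp: zero_less_mult_iff mult.commute[of 4])
  then have "k = 1 \<or> k = 2 \<or> k = 3 \<or> k = 4" by auto
  with k show ?thesis by auto
qed

lemma EDS_initial:
  "EDS B C D 1 = 1" "EDS B C D 2 = B" "EDS B C D 3 = C" "EDS B C D 4 = B * D"
  by (simp_all add: EDS_def eds_tilde_initial)

lemma weakly_elliptic_classification:
  fixes h :: "int \<Rightarrow> 'a::field"
  assumes h: "weakly_elliptic h"
  shows "(\<exists>r A B C D. r > 0 \<and> odd r \<and> (\<forall>n>0. h n = A * dilate r (EDS B C D) n)) \<or>
      (\<exists>r s A B D. r > 0 \<and> s > 0 \<and> (even r \<longleftrightarrow> odd s) \<and> r < s \<and> s \<noteq> 2 * r \<and>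
         (\<forall>n>0. h n = A * ES r s B D n)) \<or>
      (\<exists>r A C. r > 0 \<and> even r \<and> (\<forall>n>0. h n = A * dilate r (EDS 0 C 0) n))"
proof (cases "\<forall>n>0. h n = 0")
  case True
  \<comment> \<open>The zero sequence is of form (i) with r = 1 and A = 0.\<close>
  then show ?thesis by (intro disjI1 exI[of _ 1] exI[of _ 0]) simp
next
  case False
  then obtain n0 where "n0 > 0" "h n0 \<noteq> 0" by blast
  then obtain r where r: "r > 0" "h r \<noteq> 0" and "\<And>m. 0 < m \<Longrightarrow> m < r \<Longrightarrow> \<not> h m \<noteq> 0"
    by (rule int_least[of n0 "\<lambda>n. h n \<noteq> 0"]) blast
  then have r_least: "h m = 0" if "0 < m" "m < r" for m using that by blast
  have same: "h n = 0" if n: "even (n - r)" "0 < n" "n < 3 * r" "n \<noteq> r" for n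
  proof (cases "n < r")
    case False
    obtain k where "n - r = 2 * k" using n(1) by (rule evenE)
    then have k: "n = r + 2 * k" "0 < k" "k < r" using n False by auto
    \<comment> \<open>In the relation for (r+k, r, k) the other two terms contain h(k) or h(r-k),
      which vanish by minimality of r.\<close>
    have "h n * h r * (h r)^2 = 0"
      using weakly_ellipticD[OF h, of r "r + k" k] k r_least[of k] r_least[of "r - k"]
      by (simp add: algebra_simps)
    with r show ?thesis by simp
  qed (use n r_least in auto)
  show ?thesis
  proof (cases "\<forall>n>0. odd (n - r) \<longrightarrow> h n = 0")
    case True
    define C where "C = h (3 * r) / h r"
    have "h n = h r * dilate r (EDS 0 C 0) n" if "n > 0" for n
    proof (rule weakly_elliptic_eqI[OF h _ r _ _ that])
      show "weakly_elliptic (\<lambda>n. h r * dilate r (EDS 0 C 0) n)"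
        using r by (intro elliptic_imp_weakly_elliptic elliptic_dilate_EDS) auto
      show "h n = h r * dilate r (EDS 0 C 0) n" if "0 < n" "n \<le> 3 * r" "even (n - r)" for n
      proof (cases "r dvd n")
        case True
        then show ?thesis
          using multiple_le_four_cases[OF r(1) True] same[of n] that r
          by (auto simp: dilate_def EDS_initial C_def)
      next
        case False
        then have "n \<noteq> r" "n \<noteq> 3 * r" by auto
        then show ?thesis using same[of n] that False by (simp add: dilate_def)
      qed
      have "dilate r (EDS 0 C 0) n = 0" if n: "odd (n - r)" for n
      proof (cases "r dvd n")
        case True
        then obtain k where k: "n = r * k" by (rule dvdE)
        then have "even k" using n by auto
        then show ?thesis using k r by (simp add: dilate_def EDS_def)
      qed (simp add: dilate_def)
      then show "(\<forall>n>0. odd (n - r) \<longrightarrow> h n = h r * dilate r (EDS 0 C 0) n) \<or>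
        (\<exists>s>0. odd (s - r) \<and> h s \<noteq> 0 \<and> (\<forall>n. 0 < n \<and> n \<le> s + 2 * r \<and> odd (n - r) \<longrightarrow> h n = h r * dilate r (EDS 0 C 0) n))"
        using True by simp
    qed
    \<comment> \<open>This is form (iii) for even r, and form (i) with B = D = 0 for odd r.\<close>
    with r show ?thesis by blast
  next
    case False
    then obtain n1 where "n1 > 0" "odd (n1 - r) \<and> h n1 \<noteq> 0" by blast
    then obtain s where s: "s > 0" "odd (s - r)" "h s \<noteq> 0"
      and "\<And>m. 0 < m \<Longrightarrow> m < s \<Longrightarrow> \<not> (odd (m - r) \<and> h m \<noteq> 0)"
      by (rule int_least[of n1 "\<lambda>n. odd (n - r) \<and> h n \<noteq> 0"]) blast
    then have s_least: "h m = 0" if "0 < m" "m < s" "odd (m - r)" for m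
      using that by blast
    have "s \<noteq> r" "\<not> s < r" using s r_least[of s] by auto
    then have "r < s" by simp
    have opp: "h n = 0" if "odd (n - r)" "0 < n" "n < s + 2 * r" "n \<noteq> s" for n
    proof (cases "n < s")
      case False
      have "even (n - s)" using that s by auto
      then obtain k where "n - s = 2 * k" by (rule evenE)
      then have k: "n = s + 2 * k" "0 < k" "k < r" using that False by auto
      \<comment> \<open>The same argument with the relation for (s+k, r, k).\<close>
      have "h n * h s * (h r)^2 = 0"
        using weakly_ellipticD[OF h, of r "s + k" k] k r_least[of k] r_least[of "r - k"] \<open>r < s\<close>
        by (simp add: algebra_simps)
      with r s show ?thesis by simp
    qed (use that s_least in auto)
    show ?thesis
    proof (cases "s = 2 * r")
      case True
      then have "odd r" using s by simp
      \<comment> \<open>Read off from h at r, 2r, 3r, 4r, where EDS takes the values 1, B, C,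
        BD.\<close>
      define A B C D where "A = h r" and "B = h s / A" and "C = h (3 * r) / A"
        and "D = h (4 * r) / (A * B)"
      have nz: "A \<noteq> 0" "B \<noteq> 0" using r s by (auto simp: A_def B_def)
      have "h n = A * dilate r (EDS B C D) n" if "n > 0" for n
      proof (rule weakly_elliptic_eqI[OF h _ r _ _ that])
        show "weakly_elliptic (\<lambda>n. A * dilate r (EDS B C D) n)"
          using r \<open>odd r\<close> by (intro elliptic_imp_weakly_elliptic elliptic_dilate_EDS) auto
        show "h n = A * dilate r (EDS B C D) n" if "0 < n" "n \<le> 3 * r" "even (n - r)" for n
        proof (cases "r dvd n")
          case True
          then show ?thesis
            using multiple_le_four_cases[OF r(1) True] that r \<open>odd r\<close>
            by (auto simp: dilate_def EDS_initial C_def A_def)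
        next
          case False
          then have "n \<noteq> r" "n \<noteq> 3 * r" by auto
          then show ?thesis using same[of n] that False by (simp add: dilate_def)
        qed
        have "h n = A * dilate r (EDS B C D) n" if n: "0 < n" "n \<le> s + 2 * r" "odd (n - r)" for n
        proof (cases "n = 2 * r \<or> n = 4 * r")
          case n_eq: True
          then show ?thesis
            using nz r \<open>s = 2 * r\<close> by (auto simp: dilate_def EDS_initial B_def D_def)
        next
          case n_neq: False
          have "\<not> r dvd n"
            using multiple_le_four_cases[OF r(1), of n] n n_neq \<open>odd r\<close> True by auto
          then show ?thesis
            using n n_neq opp[of n] True by (simp add: dilate_def)
        qed
        then show "(\<forall>n>0. odd (n - r) \<longrightarrow> h n = A * dilate r (EDS B C D) n) \<or>
          (\<exists>s>0. odd (s - r) \<and> h s \<noteq> 0 \<and> (\<forall>n. 0 < n \<and> n \<le> s + 2 * r \<and> odd (n - r) \<longrightarrow> h n = A * dilate r (EDS B C D) n))"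
          using s by blast
      qed
      with r \<open>odd r\<close> show ?thesis by blast
    next
      case False
      have rs: "0 < r" "r < s" "even r \<longleftrightarrow> odd s" using r s \<open>r < s\<close> by auto
      have "h (2 * r) = 0"
        using opp[of "2 * r"] same[of "2 * r"] r \<open>r < s\<close> False by (cases "even r") auto
      moreover have "h \<bar>s - 2 * r\<bar> = 0"
        using s_least[of "\<bar>s - 2 * r\<bar>"] \<open>r < s\<close> False rs by auto
      \<comment> \<open>The relation for s, 2r (larger one first) and r reduces to h(3r) h(r) h(s)^2
        = 0, since h vanishes at 2r and at the distance of s and 2r.\<close>
      ultimately have h3: "h (3 * r) = 0"
        using weakly_ellipticD[OF h, of "2 * r" s r] weakly_ellipticD[OF h, of s "2 * r" r] r s \<open>r < s\<close> False
        by (cases "s < 2 * r") (auto simp: abs_if)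
      \<comment> \<open>Read off from h at r, s, s+2r, where ES takes the values 1, -B, D.\<close>
      define A B D where "A = h r" and "B = - h s / A" and "D = h (s + 2 * r) / A"
      have "A \<noteq> 0" using r by (simp add: A_def)
      have ES: "ES r s B D r = 1" "ES r s B D s = - B" "ES r s B D (s + 2 * r) = D"
        using ES_plus[OF rs(1,2), of B D 0] ES_minus[OF rs(1,2), of B D 1] ES_plus[OF rs(1,2), of B D 1]
        by (simp_all add: algebra_simps)
      have "h n = A * ES r s B D n" if "n > 0" for n
      proof (rule weakly_elliptic_eqI[OF h _ r _ _ that])
        show "weakly_elliptic (\<lambda>n. A * ES r s B D n)"
          using rs by (intro elliptic_imp_weakly_elliptic elliptic_ES)
        show "h n = A * ES r s B D n" if "0 < n" "n \<le> 3 * r" "even (n - r)" for n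
          using ES_support(1)[OF rs, of n B D] same[of n] that h3 ES(1)
          by (cases "n = r"; cases "n = 3 * r") (auto simp: A_def)
        have "h n = A * ES r s B D n" if "0 < n" "n \<le> s + 2 * r" "odd (n - r)" for n
          using ES_support(2)[OF rs, of n B D] opp[of n] that ES(2,3) \<open>A \<noteq> 0\<close>
          by (cases "n = s"; cases "n = s + 2 * r") (auto simp: B_def D_def)
        then show "(\<forall>n>0. odd (n - r) \<longrightarrow> h n = A * ES r s B D n) \<or>
          (\<exists>s'>0. odd (s' - r) \<and> h s' \<noteq> 0 \<and> (\<forall>n. 0 < n \<and> n \<le> s' + 2 * r \<and> odd (n - r) \<longrightarrow> h n = A * ES r s B D n))"
          using s by blast
      qed
      with rs s False show ?thesis by blast
    qed
  qed
qed

theorem theorem6p2: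
  shows "(\<forall>h :: int \<Rightarrow> 'a::field.
      (\<forall>m n r. m > n \<and> n > r \<and> r > 0 \<longrightarrow>
         h (m + n) * h (m - n) * (h r)^2 =
           h (m + r) * h (m - r) * (h n)^2 - h (n + r) * h (n - r) * (h m)^2) \<longrightarrow>
      (\<exists>r A B C D. r > 0 \<and> odd r \<and> (\<forall>n>0. h n = A * dilate r (EDS B C D) n)) \<or>
      (\<exists>r s A B D. r > 0 \<and> s > 0 \<and> (even r \<longleftrightarrow> odd s) \<and> r < s \<and> s \<noteq> 2 * r \<and>
         (\<forall>n>0. h n = A * ES r s B D n)) \<or>
      (\<exists>r A C. r > 0 \<and> even r \<and> (\<forall>n>0. h n = A * dilate r (EDS 0 C 0) n)))
    \<and> (\<forall>r (A::'a) B C D. r > 0 \<and> odd r \<longrightarrow>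
         elliptic (\<lambda>n. A * dilate r (EDS B C D) n))
    \<and> (\<forall>r s (A::'a) B D. r > 0 \<and> s > 0 \<and> (even r \<longleftrightarrow> odd s) \<and> r < s \<and> s \<noteq> 2 * r \<longrightarrow>
         elliptic (\<lambda>n. A * ES r s B D n))
    \<and> (\<forall>r (A::'a) C. r > 0 \<and> even r \<longrightarrow>
         elliptic (\<lambda>n. A * dilate r (EDS 0 C 0) n))"
  using weakly_elliptic_classification[unfolded weakly_elliptic_def, where ?'a = 'a]
  by (intro conjI allI impI elliptic_dilate_EDS elliptic_ES) (blast | simp)+

end
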